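(* The generating function $$G(t,x)=\sum_{k=0}^\infty h_k(x)t^k$$ of the orthonormal Hermite polynomials $(h_k)$ is continuous for $(t,x)\in\mathbb D\times\mathbb R$ and satisfies $G(t,x)>0$ for $-1<t<1$, $x\in\mathbb R$.
   Context: $\mathbb D$ denotes the open unit disc in the complex plane. $H_n$, $n=0,1,\ldots$, denotes the sequence of Hermite polynomials satisfying the orthogonality relation $\frac{1}{\sqrt\pi}\int_{-\infty}^\infty H_n(x)H_m(x)e^{-x^2}\,dx=2^n n!\,\delta_{nm}$, with generating function $\sum_{k=0}^\infty \frac{H_k(x)}{k!}z^k=e^{2xz-z^2}$ for $x,z\in\mathbb C$. The corresponding orthonormal polynomials are $h_n(x)=H_n(x)/\sqrt{2^n n!}$. *)

theory Defs
  imports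
    "HOL-Probability.Probability"
    "HOL-Complex_Analysis.Complex_Analysis"
    "HOL-Computational_Algebra.Polynomial"
begin

text \<open>
  The physicists' Hermite polynomials, by the three-term recurrence
  \<open>H\<^sub>n\<^sub>+\<^sub>2 = 2 x H\<^sub>n\<^sub>+\<^sub>1 - 2 (n + 1) H\<^sub>n\<close>.  The two properties by which the sequence is usually
  characterised, the generating function and the orthogonality relation (which fix the
  normalisation), are proved below as \<open>hermite_poly_sums\<close> and \<open>hermite_poly_orthogonal\<close>.
\<close>

fun hermite_poly :: "nat \<Rightarrow> 'a::comm_ring_1 poly" where
  "hermite_poly 0 = 1"
| "hermite_poly (Suc 0) = [:0, 2:]"
| "hermite_poly (Suc (Suc n)) =
     [:0, 2:] * hermite_poly (Suc n) - smult (2 * of_nat (Suc n)) (hermite_poly n)"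

definition orthonormal_hermite :: "nat \<Rightarrow> real \<Rightarrow> real" where
  "orthonormal_hermite n x = poly (hermite_poly n) x / sqrt (2 ^ n * fact n)"

text \<open>
  As \<open>suminf\<close> is total, the value is meaningful only where the series converges.
\<close>

definition hermite_gen :: "complex \<Rightarrow> real \<Rightarrow> complex" where
  "hermite_gen t x = (\<Sum>k. complex_of_real (orthonormal_hermite k x) * t ^ k)"

lemma pderiv_hermite_poly:
  "pderiv (hermite_poly (Suc n) :: 'a::idom poly) = smult (2 * of_nat (Suc n)) (hermite_poly n)"
proof (induction n rule: less_induct)
  case (less n)
  show ?case
  proof (cases n)
    case 0
    then show ?thesis by (simp add: pderiv_pCons)
  next
    case (Suc m)
    show ?thesis
    proof (cases m)
      case 0
      then show ?thesis using Suc
        by (simp add: pderiv_pCons pderiv_mult pderiv_diff pderiv_smult algebra_simps)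
    next
      case (Suc k)
      have 1: "pderiv (hermite_poly (Suc (Suc k)) :: 'a poly)
                 = smult (2 * of_nat (Suc (Suc k))) (hermite_poly (Suc k))"
        using less.IH[of "Suc k"] \<open>n = Suc m\<close> Suc by simp
      have 2: "pderiv (hermite_poly (Suc k) :: 'a poly)
                 = smult (2 * of_nat (Suc k)) (hermite_poly k)"
        using less.IH[of k] \<open>n = Suc m\<close> Suc by simp
      have 3: "pderiv (hermite_poly (Suc (Suc (Suc k))) :: 'a poly) =
        [:2:] * hermite_poly (Suc (Suc k)) + [:0,2:] * pderiv (hermite_poly (Suc (Suc k)))
        - smult (2 * of_nat (Suc (Suc k))) (pderiv (hermite_poly (Suc k)))"
        by (subst hermite_poly.simps(3))
           (simp only: pderiv_mult pderiv_diff pderiv_smult, simp add: pderiv_pCons)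
      have 4: "hermite_poly (Suc (Suc k)) = [:0, 2:] * hermite_poly (Suc k)
          - smult (2 * of_nat (Suc k)) (hermite_poly k :: 'a poly)"
        by simp
      have 5: "pderiv (hermite_poly (Suc (Suc (Suc k))) :: 'a poly) =
        smult 2 (hermite_poly (Suc (Suc k))) + smult (2 * of_nat (Suc (Suc k)))
          ([:0,2:] * hermite_poly (Suc k) - smult (2 * of_nat (Suc k)) (hermite_poly k))"
        unfolding 3 1 2 by (simp add: smult_diff_right mult.commute mult.assoc mult.left_commute)
      then show ?thesis
        unfolding 4[symmetric] \<open>n = Suc m\<close> Suc
        by (simp add: algebra_simps smult_add_left[symmetric] del: hermite_poly.simps)
    qed
  qed
qed

lemma hermite_poly_Suc:
  "hermite_poly (Suc n) = [:0, 2:] * hermite_poly n - pderiv (hermite_poly n :: 'a::idom poly)"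
proof (cases n)
  case (Suc m)
  then show ?thesis by (simp only: pderiv_hermite_poly hermite_poly.simps)
qed (simp add: pderiv_1)

lemma higher_deriv_hermite_exp:
  "(deriv ^^ n) (\<lambda>z. exp (2 * x * z - z ^ 2)) =
     (\<lambda>z::complex. poly (hermite_poly n) (x - z) * exp (2 * x * z - z ^ 2))"
proof (induction n)
  case (Suc n)
  have "((\<lambda>z. poly (hermite_poly n) (x - z) * exp (2 * x * z - z ^ 2)) has_field_derivative
          poly (hermite_poly (Suc n)) (x - z) * exp (2 * x * z - z ^ 2)) (at z)" for z
  proof -
    have "((\<lambda>z. poly (hermite_poly n) (x - z)) has_field_derivative
            - poly (pderiv (hermite_poly n)) (x - z)) (at z)"
      by (auto intro!: derivative_eq_intros DERIV_chain2[OF poly_DERIV, where s = UNIV, simplified])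
    from DERIV_mult[OF this, of "\<lambda>z. exp (2 * x * z - z ^ 2)" "(2 * x - 2 * z) * exp (2 * x * z - z ^ 2)"]
    show ?thesis
      unfolding hermite_poly_Suc
      by (rule DERIV_cong) (auto intro!: derivative_eq_intros simp: algebra_simps)
  qed
  then have "deriv (\<lambda>z. poly (hermite_poly n) (x - z) * exp (2 * x * z - z ^ 2)) =
      (\<lambda>z. poly (hermite_poly (Suc n)) (x - z) * exp (2 * x * z - z ^ 2))"
    by (intro ext DERIV_imp_deriv)
  then show ?case using Suc by simp
qed simp

lemma hermite_poly_sums:
  fixes x z :: complex
  shows "(\<lambda>k. poly (hermite_poly k) x / fact k * z ^ k) sums exp (2 * x * z - z ^ 2)"
proof -
  have "(\<lambda>k. (deriv ^^ k) (\<lambda>z. exp (2 * x * z - z ^ 2)) 0 / fact k * (z - 0) ^ k)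
          sums exp (2 * x * z - z ^ 2)"
    by (rule holomorphic_power_series[where r = "norm z + 1"]) (auto intro!: holomorphic_intros)
  then show ?thesis by (simp add: higher_deriv_hermite_exp)
qed

lemma normal_density_half: "normal_density 0 (sqrt (1/2)) x = exp (- x\<^sup>2) / sqrt pi"
  by (simp add: normal_density_def)

lemma integrable_poly_gauss: "integrable lborel (\<lambda>x::real. poly p x * exp (- x\<^sup>2))"
proof -
  have "integrable lborel (\<lambda>x::real. x ^ k * exp (- x\<^sup>2))" for k
  proof -
    have eq: "(\<lambda>x::real. x ^ k * exp (- x\<^sup>2)) =
        (\<lambda>x. sqrt pi * (normal_density 0 (sqrt (1/2)) x * (x - 0) ^ k))"
      by (simp add: normal_density_half fun_eq_iff)
    show ?thesis
      unfolding eq by (intro integrable_mult_right integrable_normal_moment) simp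
  qed
  then have "integrable lborel (\<lambda>x. \<Sum>i\<le>degree p. coeff p i * (x ^ i * exp (- x\<^sup>2)))"
    by (intro Bochner_Integration.integrable_sum integrable_mult_right)
  then show ?thesis by (simp add: poly_altdef sum_distrib_right mult.assoc)
qed

lemma integral_monom_gauss:
  "(LBINT x. poly (monom 1 (2 * k)) x * exp (- x\<^sup>2)) = sqrt pi * fact (2 * k) / (4 ^ k * fact k)"
  "(LBINT x::real. poly (monom 1 (Suc (2 * k))) x * exp (- x\<^sup>2)) = 0"
proof -
  have *: "(LBINT x. poly (monom 1 n) x * exp (- x\<^sup>2)) =
      sqrt pi * (LBINT x. normal_density 0 (sqrt (1/2)) x * (x - 0) ^ n)" for n
    by (subst integral_mult_right_zero[symmetric])
       (simp add: normal_density_half poly_monom mult.commute)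
  show "(LBINT x. poly (monom 1 (2 * k)) x * exp (- x\<^sup>2)) = sqrt pi * fact (2 * k) / (4 ^ k * fact k)"
    unfolding * by (subst integral_normal_moment_even) (simp_all add: power_divide)
  show "(LBINT x::real. poly (monom 1 (Suc (2 * k))) x * exp (- x\<^sup>2)) = 0"
    unfolding * using integral_normal_moment_odd[of "sqrt (1/2)" 0 k] by simp
qed

lemma integral_gauss_monom_parts:
  "(LBINT x. poly (pderiv (monom 1 k)) x * exp (- x\<^sup>2)) =
     2 * (LBINT x::real. poly (monom 1 (Suc k)) x * exp (- x\<^sup>2))"
proof (cases "even k")
  case True
  then obtain j where j: "k = 2 * j" by (elim evenE)
  show ?thesis
  proof (cases j)
    case 0
    then show ?thesis using j integral_monom_gauss(2)[of 0] by (simp add: monom_0 pderiv_1)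
  next
    case (Suc i)
    have "poly (pderiv (monom 1 k)) x = real k * poly (monom 1 (Suc (2 * i))) x" for x
      using j Suc by (simp add: pderiv_monom poly_monom)
    then show ?thesis
      using integral_monom_gauss(2)[of i] integral_monom_gauss(2)[of j] j
      by (simp add: mult.assoc)
  qed
next
  case False
  then obtain j where j: "k = Suc (2 * j)" by (metis oddE Suc_eq_plus1)
  have e: "Suc k = 2 * Suc j" using j by simp
  have d: "poly (pderiv (monom 1 k)) x = real k * poly (monom 1 (2 * j)) x" for x
    using j by (simp add: pderiv_monom poly_monom)
  have "(LBINT x. poly (pderiv (monom 1 k)) x * exp (- x\<^sup>2)) =
      real k * (sqrt pi * fact (2 * j) / (4 ^ j * fact j))"
    unfolding d mult.assoc integral_mult_right_zero integral_monom_gauss(1) ..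
  also have "\<dots> = 2 * (sqrt pi * fact (2 * Suc j) / (4 ^ Suc j * fact (Suc j)))"
    using j by (simp add: divide_simps)
  finally show ?thesis unfolding e integral_monom_gauss(1) .
qed

lemma pderiv_sum_poly: "pderiv (\<Sum>i\<in>A. f i) = (\<Sum>i\<in>A. pderiv (f i :: 'a::idom poly))"
  by (induction A rule: infinite_finite_induct) (simp_all add: pderiv_add)

lemma integral_gauss_parts:
  fixes p :: "real poly"
  shows "(LBINT x. poly (pderiv p) x * exp (- x\<^sup>2)) = (LBINT x. poly ([:0, 2:] * p) x * exp (- x\<^sup>2))"
proof -
  have deg: "p = (\<Sum>i\<le>degree p. smult (coeff p i) (monom 1 i))"
    by (simp add: smult_monom poly_as_sum_of_monoms)
  have l: "poly (pderiv p) x * exp (- x\<^sup>2) =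
      (\<Sum>i\<le>degree p. coeff p i * (poly (pderiv (monom 1 i)) x * exp (- x\<^sup>2)))" for x
    by (subst deg) (simp only: pderiv_sum_poly poly_sum pderiv_smult poly_smult sum_distrib_right mult.assoc)
  have r: "poly ([:0, 2:] * p) x * exp (- x\<^sup>2) =
      (\<Sum>i\<le>degree p. coeff p i * (2 * (poly (monom 1 (Suc i)) x * exp (- x\<^sup>2))))" for x
    by (simp add: poly_altdef[of p] sum_distrib_left sum_distrib_right poly_monom mult_ac)
  show ?thesis
    unfolding l r
    by (subst (1 2) Bochner_Integration.integral_sum)
       (auto intro!: integrable_poly_gauss integrable_mult_right simp: integral_gauss_monom_parts)
qed

lemma integral_hermite_Suc:
  fixes p :: "real poly"
  shows "(LBINT x. poly (p * hermite_poly (Suc n)) x * exp (- x\<^sup>2)) =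
         (LBINT x. poly (pderiv p * hermite_poly n) x * exp (- x\<^sup>2))"
proof -
  let ?I = "\<lambda>q. LBINT x. poly q x * exp (- x\<^sup>2)"
  have add: "?I (q + r) = ?I q + ?I r" for q r :: "real poly"
    by (simp add: distrib_right integrable_poly_gauss)
  have "p * hermite_poly (Suc n) + p * pderiv (hermite_poly n) = [:0, 2:] * (p * hermite_poly n)"
    unfolding hermite_poly_Suc by (simp only: algebra_simps)
  then have "?I (p * hermite_poly (Suc n)) + ?I (p * pderiv (hermite_poly n)) =
      ?I (pderiv (p * hermite_poly n))"
    by (simp only: add[symmetric] integral_gauss_parts)
  also have "\<dots> = ?I (p * pderiv (hermite_poly n)) + ?I (pderiv p * hermite_poly n)"
    by (simp only: pderiv_mult add mult.commute[of "hermite_poly n" "pderiv p"])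
  finally show ?thesis by simp
qed

lemma hermite_poly_orthogonal_aux:
  "(LBINT x. poly (hermite_poly n * hermite_poly m) x * exp (- x\<^sup>2)) =
     (if n = m then sqrt pi * 2 ^ n * fact n else 0)"
proof (induction n arbitrary: m)
  case 0
  show ?case
  proof (cases m)
    case 0
    then show ?thesis using integral_monom_gauss(1)[of 0] by simp
  next
    case (Suc k)
    then show ?thesis using integral_hermite_Suc[of 1 k] by (simp add: pderiv_1)
  qed
next
  case (Suc n)
  show ?case
  proof (cases m)
    case 0
    then show ?thesis using integral_hermite_Suc[of 1 n] by (simp add: pderiv_1)
  next
    case (Suc k)
    have "(LBINT x. poly (hermite_poly (Suc n) * hermite_poly (Suc k)) x * exp (- x\<^sup>2)) =
      (LBINT x. 2 * real (Suc n) * (poly (hermite_poly n * hermite_poly k) x * exp (- x\<^sup>2)))"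
      unfolding integral_hermite_Suc pderiv_hermite_poly by (simp add: mult_ac)
    also have "\<dots> = 2 * real (Suc n) * (if n = k then sqrt pi * 2 ^ n * fact n else 0)"
      unfolding integral_mult_right_zero Suc.IH ..
    finally show ?thesis using Suc by simp
  qed
qed

lemma hermite_poly_orthogonal:
  "1 / sqrt pi * (LBINT x. poly (hermite_poly n) x * poly (hermite_poly m) x * exp (- x\<^sup>2)) =
     (if n = m then 2 ^ n * fact n else 0)"
  using hermite_poly_orthogonal_aux[of n m] by simp

end

theory Submission
  imports Defs
begin

text \<open>
  Convergence and continuity are routine: the three-term recurrence bounds \<open>\<bar>h\<^sub>k(x)\<bar>\<close> for
  \<open>\<bar>x\<bar> \<le> R\<close> by a product of factors that tend to 1 (\<open>abs_orthonormal_hermite_le\<close>), so the series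
  converges locally uniformly on the disc times the line.

  Positivity rests on the fact that \<open>\<surd>(k!)\<close> is a moment sequence of a positive measure \<open>\<mu>\<close> on
  the half-line.  As \<open>h\<^sub>k(x) = \<surd>(k!) \<cdot> (H\<^sub>k(x) / k!) \<cdot> 2\<^sup>-\<^sup>k\<^sup>/\<^sup>2\<close>, the generating function is the
  average \<open>G(t,x) = \<integral> exp (\<surd>2 x t s - (t s)\<^sup>2/2) d\<mu>(s)\<close> of a positive function.  The measure itself
  is avoided: what is needed is only that replacing the coefficients \<open>c\<^sub>k\<close> of an entire function
  by \<open>\<surd>(k!) c\<^sub>k\<close> preserves nonnegativity on the real line (\<open>suminf_sqrt_fact_nonneg\<close>).  By Euler's
  limit formula, \<open>k!\<close> is the limit of \<open>n\<^sup>k \<Prod>\<^sub>j\<^sub>\<le>\<^sub>n j/(j+k)\<close>.  Hence it suffices to treat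
  a single factor \<open>\<surd>(j/(j+k))\<close>, and this one is the expectation of \<open>(exp (-V\<^sup>2))\<^sup>k\<close> for a Gaussian
  variable \<open>V\<close>, so that inserting it averages the function over smaller arguments
  (\<open>suminf_gaussian_nonneg\<close>).

  The limit gives only \<open>G \<ge> 0\<close>.  Strict positivity comes from Jensen's inequality.  The
  exponential lies above its tangent, so the exponential minus a suitable quadratic
  polynomial in \<open>s\<close> is nonnegative, and the transform of this polynomial at \<open>t\<close> is a positive
  number because the point of tangency is the mean of the exponent.
\<close>

section \<open>Growth of the orthonormal Hermite polynomials\<close>

lemma orthonormal_hermite_0: "orthonormal_hermite 0 x = 1"
  by (simp add: orthonormal_hermite_def)

lemma orthonormal_hermite_1: "orthonormal_hermite (Suc 0) x = sqrt 2 * x"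
  by (simp add: orthonormal_hermite_def field_simps)

lemma orthonormal_hermite_rec:
  "orthonormal_hermite (Suc (Suc n)) x =
     sqrt 2 * x / sqrt (real (n + 2)) * orthonormal_hermite (Suc n) x
     - sqrt (real (n + 1) / real (n + 2)) * orthonormal_hermite n x"
proof -
  define D where "D = sqrt (2 ^ n * fact n)"
  define a b where "a = sqrt (real (n + 1))" and "b = sqrt (real (n + 2))"
  have pos: "D > 0" "a > 0" "b > 0" by (auto simp: D_def a_def b_def)
  have aa: "a * a = real n + 1" by (simp add: a_def)
  have D1: "sqrt (2 ^ Suc n * fact (Suc n)) = sqrt 2 * a * D"
    unfolding D_def a_def real_sqrt_mult[symmetric] by (simp add: mult_ac)
  have D2: "sqrt (2 ^ Suc (Suc n) * fact (Suc (Suc n))) = 2 * a * b * D"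
  proof -
    have "2 * a * b * D = sqrt 4 * a * b * D" by simp
    then show ?thesis
      unfolding D_def a_def b_def real_sqrt_mult[symmetric]
      by (simp only: real_sqrt_eq_iff) (simp add: algebra_simps)
  qed
  have ab: "sqrt (real (n + 1) / real (n + 2)) = a / b"
    by (simp only: a_def b_def real_sqrt_divide)
  let ?p = "poly (hermite_poly n) x" and ?q = "poly (hermite_poly (Suc n)) x"
  have "orthonormal_hermite (Suc (Suc n)) x = (2 * x * ?q - 2 * (a * a) * ?p) / (2 * a * b * D)"
    unfolding orthonormal_hermite_def D2 aa by (simp add: algebra_simps)
  also have "\<dots> = sqrt 2 * x / b * (?q / (sqrt 2 * a * D)) - a / b * (?p / D)"
    using pos by (simp add: field_simps)
  finally show ?thesis
    unfolding ab unfolding orthonormal_hermite_def D1 D_def[symmetric] b_def[symmetric] .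
qed

definition hermite_bound :: "real \<Rightarrow> nat \<Rightarrow> real" where
  "hermite_bound R n = (\<Prod>k<n. 1 + sqrt 2 * R / sqrt (real (Suc k)))"

lemma hermite_bound_Suc:
  "hermite_bound R (Suc n) = hermite_bound R n * (1 + sqrt 2 * R / sqrt (real (Suc n)))"
  by (simp add: hermite_bound_def)

lemma hermite_bound_nonneg: "R \<ge> 0 \<Longrightarrow> hermite_bound R n \<ge> 0"
  unfolding hermite_bound_def by (intro prod_nonneg) auto

text \<open>
  In the recurrence the coefficient of \<open>h\<^sub>n\<close> is at most 1 and that of \<open>h\<^sub>n\<^sub>+\<^sub>1\<close> tends to 0, so one
  step increases the maximum of two consecutive values at most by the next factor of the product.
\<close>

lemma abs_orthonormal_hermite_le:
  assumes "\<bar>x\<bar> \<le> R"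
  shows "\<bar>orthonormal_hermite n x\<bar> \<le> hermite_bound R n"
proof -
  have R: "R \<ge> 0" using assms by linarith
  have mono: "hermite_bound R n \<le> hermite_bound R (Suc n)" for n
    unfolding hermite_bound_Suc
    using mult_left_mono[OF _ hermite_bound_nonneg[OF R, of n],
            of 1 "1 + sqrt 2 * R / sqrt (real (Suc n))"] R by simp
  have "\<bar>orthonormal_hermite n x\<bar> \<le> hermite_bound R n \<and>
        \<bar>orthonormal_hermite (Suc n) x\<bar> \<le> hermite_bound R (Suc n)"
  proof (induction n)
    case 0
    have "\<bar>sqrt 2 * x\<bar> \<le> sqrt 2 * R" using assms by (simp add: abs_mult)
    then show ?case
      by (simp add: orthonormal_hermite_0 orthonormal_hermite_1 hermite_bound_def)
  next
    case (Suc n)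
    let ?e = "sqrt 2 * R / sqrt (real (Suc (Suc n)))"
    have "\<bar>sqrt 2 * x / sqrt (real (n + 2)) * orthonormal_hermite (Suc n) x\<bar>
            = sqrt 2 * \<bar>x\<bar> / sqrt (real (n + 2)) * \<bar>orthonormal_hermite (Suc n) x\<bar>"
      by (simp add: abs_mult)
    also have "\<dots> \<le> ?e * hermite_bound R (Suc n)"
      using Suc assms R
      by (intro mult_mono) (simp_all add: divide_right_mono mult_left_mono add.commute)
    finally have 1: "\<bar>sqrt 2 * x / sqrt (real (n + 2)) * orthonormal_hermite (Suc n) x\<bar>
        \<le> ?e * hermite_bound R (Suc n)" .
    have "\<bar>sqrt (real (n + 1) / real (n + 2)) * orthonormal_hermite n x\<bar>
            = sqrt (real (n + 1) / real (n + 2)) * \<bar>orthonormal_hermite n x\<bar>"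
      by (simp add: abs_mult)
    also have "\<dots> \<le> 1 * hermite_bound R (Suc n)"
      using Suc mono[of n] by (intro mult_mono) auto
    finally have 2: "\<bar>sqrt (real (n + 1) / real (n + 2)) * orthonormal_hermite n x\<bar>
        \<le> hermite_bound R (Suc n)" by simp
    have "\<bar>orthonormal_hermite (Suc (Suc n)) x\<bar> \<le> ?e * hermite_bound R (Suc n) + hermite_bound R (Suc n)"
      using 1 2 unfolding orthonormal_hermite_rec by linarith
    also have "\<dots> = hermite_bound R (Suc (Suc n))"
      unfolding hermite_bound_Suc[of R "Suc n"] by (simp add: algebra_simps)
    finally show ?case using Suc by simp
  qed
  then show ?thesis ..
qed

lemma summable_hermite_bound:
  assumes R: "R \<ge> 0" and r: "0 \<le> r" "r < 1"
  shows "summable (\<lambda>n. hermite_bound R n * r ^ n)"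
proof -
  define c where "c = (1 + r) / 2"
  have c: "r < c" "c < 1" using r by (auto simp: c_def)
  have "(\<lambda>n. (1 + sqrt 2 * R / sqrt (real (Suc n))) * r) \<longlonglongrightarrow> (1 + 0) * r"
    by (intro tendsto_mult tendsto_add tendsto_const real_tendsto_divide_at_top[OF tendsto_const]
          filterlim_compose[OF sqrt_at_top]
          filterlim_compose[OF filterlim_real_sequentially filterlim_Suc])
  then have "eventually (\<lambda>n. (1 + sqrt 2 * R / sqrt (real (Suc n))) * r < c) sequentially"
    using c by (intro order_tendstoD) auto
  then obtain N where N: "\<And>n. n \<ge> N \<Longrightarrow> (1 + sqrt 2 * R / sqrt (real (Suc n))) * r < c"
    by (auto simp: eventually_sequentially)
  show ?thesis
  proof (rule summable_ratio_test[OF c(2), of N])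
    fix n assume "n \<ge> N"
    have "hermite_bound R (Suc n) * r ^ Suc n
            = ((1 + sqrt 2 * R / sqrt (real (Suc n))) * r) * (hermite_bound R n * r ^ n)"
      unfolding hermite_bound_Suc by (simp add: algebra_simps)
    also have "\<dots> \<le> c * (hermite_bound R n * r ^ n)"
      using N[OF \<open>n \<ge> N\<close>] hermite_bound_nonneg[OF R, of n] r by (intro mult_right_mono) auto
    finally show "norm (hermite_bound R (Suc n) * r ^ Suc n) \<le> c * norm (hermite_bound R n * r ^ n)"
      using hermite_bound_nonneg[OF R] r by (simp add: abs_mult)
  qed
qed

lemma norm_hermite_gen_term_le:
  assumes "norm t \<le> r" "\<bar>x\<bar> \<le> R"
  shows "norm (complex_of_real (orthonormal_hermite k x) * t ^ k) \<le> hermite_bound R k * r ^ k"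
proof -
  have "R \<ge> 0" using assms(2) by linarith
  then show ?thesis
    unfolding norm_mult norm_power using assms
    by (intro mult_mono power_mono) (auto intro: abs_orthonormal_hermite_le hermite_bound_nonneg)
qed

lemma summable_norm_hermite_gen:
  assumes "norm t < 1"
  shows "summable (\<lambda>k. norm (complex_of_real (orthonormal_hermite k x) * t ^ k))"
proof (rule summable_comparison_test'[where N = 0])
  show "summable (\<lambda>k. hermite_bound \<bar>x\<bar> k * norm t ^ k)"
    using assms by (intro summable_hermite_bound) auto
qed (use norm_hermite_gen_term_le[of t "norm t" x "\<bar>x\<bar>"] in auto)

lemma continuous_on_hermite_gen:
  "continuous_on (ball (0::complex) 1 \<times> (UNIV :: real set)) (\<lambda>(t, x). hermite_gen t x)"
proof -
  have "isCont (\<lambda>(t, x). hermite_gen t x) (t0, x0)" if t0: "norm t0 < 1" for t0 x0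
  proof -
    obtain r where r: "norm t0 < r" "r < 1" using dense[OF t0] by blast
    define R where "R = \<bar>x0\<bar> + 1"
    define U where "U = ball (0::complex) r \<times> ball (0::real) R"
    have "uniform_limit U (\<lambda>n p. \<Sum>k<n. complex_of_real (orthonormal_hermite k (snd p)) * fst p ^ k)
            (\<lambda>p. \<Sum>k. complex_of_real (orthonormal_hermite k (snd p)) * fst p ^ k) sequentially"
    proof (rule Weierstrass_m_test)
      show "summable (\<lambda>k. hermite_bound R k * r ^ k)"
        using r order.strict_trans1[OF norm_ge_zero r(1)]
        by (intro summable_hermite_bound) (auto simp: R_def)
    next
      fix k and p :: "complex \<times> real" assume "p \<in> U"
      then show "norm (complex_of_real (orthonormal_hermite k (snd p)) * fst p ^ k)
                   \<le> hermite_bound R k * r ^ k"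
        by (intro norm_hermite_gen_term_le) (auto simp: U_def)
    qed
    moreover have "continuous_on U
        (\<lambda>p. \<Sum>k<n. complex_of_real (orthonormal_hermite k (snd p)) * fst p ^ k)" for n
      unfolding orthonormal_hermite_def by (intro continuous_intros) auto
    ultimately have "continuous_on U
        (\<lambda>p. \<Sum>k. complex_of_real (orthonormal_hermite k (snd p)) * fst p ^ k)"
      by (intro uniform_limit_theorem[OF always_eventually]) auto
    then have "continuous_on U (\<lambda>(t, x). hermite_gen t x)"
      by (simp add: hermite_gen_def case_prod_unfold)
    moreover have "open U" "(t0, x0) \<in> U"
      using r by (auto simp: U_def R_def open_Times)
    ultimately show ?thesis by (simp add: continuous_on_eq_continuous_at)
  qed
  then show ?thesis
    by (intro continuous_at_imp_continuous_on) auto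
qed

section \<open>The multiplier \<open>\<surd>(k!)\<close> preserves nonnegativity\<close>

text \<open>
  The factor \<open>exp (-k v\<^sup>2)\<close> turns the centred Gaussian density of variance \<open>1/(2j)\<close> into a
  multiple of the one of variance \<open>1/(2(j+k))\<close>; the ratio of the normalising constants is the
  \<open>k\<close>-th moment of \<open>exp (-V\<^sup>2)\<close>.
\<close>

lemma has_integral_exp_power_normal:
  assumes "j > 0"
  shows "has_bochner_integral lborel
           (\<lambda>v. exp (- v\<^sup>2) ^ k * normal_density 0 (sqrt (1 / (2 * real j))) v)
           (sqrt (real j / real (j + k)))"
proof -
  have density: "normal_density 0 (sqrt (1 / (2 * real m))) v = sqrt (real m / pi) * exp (- (real m * v\<^sup>2))"
    if "m > 0" for m v
    using that by (simp add: normal_density_def real_sqrt_divide field_simps)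
  have "exp (- v\<^sup>2) ^ k * normal_density 0 (sqrt (1 / (2 * real j))) v =
          sqrt (real j / real (j + k)) * normal_density 0 (sqrt (1 / (2 * real (j + k)))) v" for v
  proof -
    have "exp (- v\<^sup>2) ^ k * exp (- (real j * v\<^sup>2)) = exp (- (real (j + k) * v\<^sup>2))"
      by (simp add: exp_of_nat_mult[symmetric] exp_add[symmetric] algebra_simps)
    moreover have "sqrt (real j / real (j + k)) * sqrt (real (j + k) / pi) = sqrt (real j / pi)"
      using assms unfolding real_sqrt_mult[symmetric] by simp
    ultimately show ?thesis
      using assms density[of j v] density[of "j + k" v]
      by (simp only: add_gr_0 mult_ac simp_thms) (simp only: mult_ac flip: mult.assoc)
  qed
  moreover have "has_bochner_integral lborel (normal_density 0 (sqrt (1 / (2 * real (j + k))))) 1"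
    using assms by (auto simp: has_bochner_integral_iff)
  ultimately show ?thesis
    using has_bochner_integral_mult_right[of "sqrt (real j / real (j + k))" lborel
        "normal_density 0 (sqrt (1 / (2 * real (j + k))))" 1] by simp
qed

text \<open>
  The multiplied series at \<open>s\<close> is the expectation of the original one at the random point
  \<open>s exp (-V\<^sup>2)\<close>.
\<close>

lemma suminf_gaussian_nonneg:
  fixes c :: "nat \<Rightarrow> real"
  assumes j: "j > 0"
    and summ: "\<And>s. summable (\<lambda>k. norm (c k * s ^ k))"
    and nonneg: "\<And>s. 0 \<le> (\<Sum>k. c k * s ^ k)"
  shows "summable (\<lambda>k. norm ((c k * sqrt (real j / real (j + k))) * s ^ k))"
    and "0 \<le> (\<Sum>k. (c k * sqrt (real j / real (j + k))) * s ^ k)"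
proof -
  define N where "N = normal_density 0 (sqrt (1 / (2 * real j)))"
  define f where "f = (\<lambda>k v. (c k * s ^ k) * (exp (- v\<^sup>2) ^ k * N v))"
  have N: "N v \<ge> 0" for v by (simp add: N_def)
  have hb: "has_bochner_integral lborel (\<lambda>v. a * (exp (- v\<^sup>2) ^ k * N v))
              (a * sqrt (real j / real (j + k)))" for a k
    unfolding N_def by (intro has_bochner_integral_mult_right has_integral_exp_power_normal j)
  have norm_f: "norm (f k v) = norm (c k * s ^ k) * (exp (- v\<^sup>2) ^ k * N v)" for k v
    using N[of v] by (simp add: f_def abs_mult)
  have f_eq: "f k v = (c k * (s * exp (- v\<^sup>2)) ^ k) * N v" for k v
    by (simp add: f_def power_mult_distrib)
  show S: "summable (\<lambda>k. norm ((c k * sqrt (real j / real (j + k))) * s ^ k))"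
  proof (rule summable_comparison_test'[OF summ[of s], where N = 0])
    fix k
    have "sqrt (real j / real (j + k)) \<le> 1" using j by simp
    then have "\<bar>c k * s ^ k\<bar> * sqrt (real j / real (j + k)) \<le> \<bar>c k * s ^ k\<bar> * 1"
      by (intro mult_left_mono) auto
    then show "norm (norm ((c k * sqrt (real j / real (j + k))) * s ^ k)) \<le> norm (c k * s ^ k)"
      by (simp add: abs_mult mult_ac)
  qed
  have int_f: "integrable lborel (f k)"
    and int_f_eq: "integral\<^sup>L lborel (f k) = (c k * sqrt (real j / real (j + k))) * s ^ k" for k
    using hb[of "c k * s ^ k" k] by (auto simp: f_def has_bochner_integral_iff)
  have int_norm: "(LBINT v. norm (f k v)) = norm ((c k * sqrt (real j / real (j + k))) * s ^ k)" for k
    unfolding norm_f has_bochner_integral_integral_eq[OF hb] by (simp add: abs_mult mult_ac)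
  have "summable (\<lambda>k. norm (f k v))" for v
    using summable_mult2[OF summ[of "s * exp (- v\<^sup>2)"], of "N v"] N[of v]
    by (simp add: f_eq abs_mult)
  then have "(LBINT v. \<Sum>k. f k v) = (\<Sum>k. integral\<^sup>L lborel (f k))"
    using S unfolding int_norm[symmetric] by (intro integral_suminf int_f) simp_all
  then have eq: "(\<Sum>k. (c k * sqrt (real j / real (j + k))) * s ^ k) = (LBINT v. \<Sum>k. f k v)"
    unfolding int_f_eq ..
  have "(\<Sum>k. f k v) = (\<Sum>k. c k * (s * exp (- v\<^sup>2)) ^ k) * N v" for v
    unfolding f_eq by (rule suminf_mult2[symmetric, OF summable_norm_cancel[OF summ]])
  then have "0 \<le> (\<Sum>k. f k v)" for v
    using N[of v] nonneg by simp
  then show "0 \<le> (\<Sum>k. (c k * sqrt (real j / real (j + k))) * s ^ k)"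
    unfolding eq by (intro integral_nonneg_AE) simp
qed

lemma suminf_gaussian_iterate_nonneg:
  fixes c :: "nat \<Rightarrow> real"
  assumes summ: "\<And>s. summable (\<lambda>k. norm (c k * s ^ k))"
    and nonneg: "\<And>s. 0 \<le> (\<Sum>k. c k * s ^ k)"
  shows "summable (\<lambda>k. norm ((c k * sqrt (fact n * fact k / fact (n + k))) * s ^ k)) \<and>
         0 \<le> (\<Sum>k. (c k * sqrt (fact n * fact k / fact (n + k))) * s ^ k)"
proof (induction n arbitrary: s)
  case 0
  show ?case using summ nonneg by simp
next
  case (Suc n)
  have "sqrt (fact n * fact k / fact (n + k)) * sqrt (real (Suc n) / real (Suc n + k))
          = sqrt (fact (Suc n) * fact k / fact (Suc n + k))" for k
    unfolding real_sqrt_mult[symmetric] by (simp add: mult_ac)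
  then have eq: "(c k * sqrt (fact n * fact k / fact (n + k))) * sqrt (real (Suc n) / real (Suc n + k))
          = c k * sqrt (fact (Suc n) * fact k / fact (Suc n + k))" for k
    by (simp only: mult.assoc)
  show ?case
    using suminf_gaussian_nonneg[of "Suc n" "\<lambda>k. c k * sqrt (fact n * fact k / fact (n + k))" s,
        OF _ Suc[THEN conjunct1] Suc[THEN conjunct2]]
    unfolding eq by blast
qed

text \<open>Euler's limit formula for the Gamma function at \<open>k + 1\<close>.\<close>

lemma Euler_limit_fact:
  "(\<lambda>n. real n ^ k * (fact n * fact k / fact (n + k))) \<longlonglongrightarrow> fact k"
  and Euler_fact_le: "real n ^ k * (fact n * fact k / fact (n + k)) \<le> fact k"
proof -
  have rec: "real n ^ Suc k * (fact n * fact (Suc k) / fact (n + Suc k)) =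
      real n ^ k * (fact n * fact k / fact (n + k)) * (real (Suc k) * (real n / real (n + Suc k)))"
    for n k
    by (simp add: field_simps)
  show "(\<lambda>n. real n ^ k * (fact n * fact k / fact (n + k))) \<longlonglongrightarrow> fact k"
  proof (induction k)
    case (Suc k)
    have "(\<lambda>n. real n / real (n + Suc k)) \<longlonglongrightarrow> 1"
      by real_asymp
    from tendsto_mult[OF Suc tendsto_mult[OF tendsto_const[of "real (Suc k)"] this]]
    show ?case unfolding rec by (simp add: mult_ac)
  qed simp
  show "real n ^ k * (fact n * fact k / fact (n + k)) \<le> fact k"
  proof (induction k)
    case (Suc k)
    have "real n ^ k * (fact n * fact k / fact (n + k)) * (real (Suc k) * (real n / real (n + Suc k)))
            \<le> fact k * (real (Suc k) * 1)"
      using Suc by (intro mult_mono) auto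
    then show ?case unfolding rec by (simp add: mult_ac)
  qed simp
qed

text \<open>
  The \<open>n\<close>-fold iterate is evaluated at \<open>\<surd>n t\<close>, which supplies the factor \<open>n\<^sup>k\<close> in Euler's
  formula; the limit is taken by dominated convergence, as the approximations stay below \<open>k!\<close>.
\<close>

lemma suminf_sqrt_fact_nonneg:
  fixes c :: "nat \<Rightarrow> real"
  assumes summ: "\<And>s. summable (\<lambda>k. norm (c k * s ^ k))"
    and nonneg: "\<And>s. 0 \<le> (\<Sum>k. c k * s ^ k)"
    and summ_t: "summable (\<lambda>k. norm (c k * sqrt (fact k) * t ^ k))"
  shows "0 \<le> (\<Sum>k. c k * sqrt (fact k) * t ^ k)"
proof -
  define w where "w = (\<lambda>k n. real n ^ k * (fact n * fact k / fact (n + k)))"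
  have w: "0 \<le> w k n" "w k n \<le> fact k" for k n
    using Euler_fact_le by (auto simp: w_def)
  have lim: "(\<lambda>n. c k * sqrt (w k n) * t ^ k) \<longlonglongrightarrow> c k * sqrt (fact k) * t ^ k" for k
    unfolding w_def by (intro tendsto_intros Euler_limit_fact)
  have conv: "(\<lambda>n. \<Sum>k. c k * sqrt (w k n) * t ^ k) \<longlonglongrightarrow> (\<Sum>k. c k * sqrt (fact k) * t ^ k)"
  proof -
    have "norm (c k * sqrt (w k n) * t ^ k) \<le> norm (c k * sqrt (fact k) * t ^ k)" for k n
      unfolding norm_mult using w[of k n]
      by (intro mult_right_mono mult_left_mono) auto
    then have "\<forall>\<^sub>F (k, n) in at_top \<times>\<^sub>F sequentially.
        norm (c k * sqrt (w k n) * t ^ k) \<le> norm (c k * sqrt (fact k) * t ^ k)"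
      by (intro always_eventually) (simp add: case_prod_unfold)
    from tannerys_theorem[OF lim this summ_t sequentially_bot] show ?thesis by blast
  qed
  have "0 \<le> (\<Sum>k. c k * sqrt (w k n) * t ^ k)" for n
  proof -
    have "c k * sqrt (w k n) * t ^ k =
        c k * sqrt (fact n * fact k / fact (n + k)) * (sqrt (real n) * t) ^ k" for k
      unfolding w_def real_sqrt_mult[of "real n ^ k"]
      by (simp add: power_mult_distrib real_sqrt_power)
    then show ?thesis
      using suminf_gaussian_iterate_nonneg[OF summ nonneg, of n "sqrt (real n) * t"] by (simp only:)
  qed
  then show ?thesis by (intro LIMSEQ_le_const[OF conv] exI allI impI)
qed

section \<open>Strict positivity\<close>

lemma poly_hermite_of_real:
  "poly (hermite_poly k) (of_real x :: complex) = of_real (poly (hermite_poly k) x)"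
  by (induction k rule: hermite_poly.induct) simp_all

lemma hermite_coeffs_sums:
  fixes x s :: real
  defines "c \<equiv> \<lambda>k. orthonormal_hermite k x / sqrt (fact k)"
  shows "(\<lambda>k. c k * s ^ k) sums exp (sqrt 2 * x * s - s\<^sup>2 / 2)"
proof -
  have c: "c k * s ^ k = poly (hermite_poly k) x / fact k * (s / sqrt 2) ^ k" for k
    by (simp add: c_def orthonormal_hermite_def real_sqrt_mult real_sqrt_power power_divide)
  have e: "2 * x * (s / sqrt 2) - (s / sqrt 2)\<^sup>2 = sqrt 2 * x * s - s\<^sup>2 / 2"
    by (simp add: power_divide field_simps)
  have "(\<lambda>k. complex_of_real (poly (hermite_poly k) x / fact k * (s / sqrt 2) ^ k)) sums
          complex_of_real (exp (2 * x * (s / sqrt 2) - (s / sqrt 2)\<^sup>2))"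
    using hermite_poly_sums[of "of_real x" "of_real (s / sqrt 2)"]
    by (simp add: poly_hermite_of_real exp_of_real[symmetric])
  then show ?thesis unfolding sums_of_real_iff c e .
qed

text \<open>
  Jensen's inequality for the averaging behind the multiplier \<open>\<surd>(k!)\<close>.  Its moments of order 0,
  1 and 2 are 1, 1 and \<open>\<surd>2\<close>, so the exponent \<open>\<surd>2 x t s - (t s)\<^sup>2/2\<close> has mean
  \<open>C = \<surd>2 x t - t\<^sup>2/\<surd>2\<close>.
\<close>

lemma orthonormal_hermite_suminf_ge:
  fixes x t :: real
  assumes "summable (\<lambda>k. norm (orthonormal_hermite k x * t ^ k))"
  shows "exp (sqrt 2 * x * t - t\<^sup>2 / sqrt 2) \<le> (\<Sum>k. orthonormal_hermite k x * t ^ k)"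
proof -
  define C where "C = sqrt 2 * x * t - t\<^sup>2 / sqrt 2"
  define c where "c = (\<lambda>k. orthonormal_hermite k x / sqrt (fact k))"
  \<comment> \<open>tangent of \<open>exp\<close> at \<open>C\<close>, taken at \<open>\<surd>2 x s - s\<^sup>2/2\<close>, as a polynomial in \<open>s\<close>\<close>
  define p where "p = smult (exp C) [:1 - C, sqrt 2 * x, - (1/2):]"
  define d where "d = (\<lambda>k. c k - coeff p k)"
  have c_sums: "(\<lambda>k. c k * s ^ k) sums exp (sqrt 2 * x * s - s\<^sup>2 / 2)" for s
    using hermite_coeffs_sums[of x s] by (simp add: c_def)
  have coeff_p: "coeff p k = 0" if "k \<notin> {..2}" for k
    using that by (auto simp: p_def coeff_pCons split: nat.splits)
  \<comment> \<open>used both for \<open>a\<^sub>k = s\<^sup>k\<close> and, after the multiplier has been applied, for \<open>a\<^sub>k = \<surd>(k!) t\<^sup>k\<close>\<close>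
  have p_sums: "(\<lambda>k. coeff p k * a k) sums
      (exp C * ((1 - C) * a 0 + sqrt 2 * x * a 1 - a 2 / 2))" for a :: "nat \<Rightarrow> real"
    using sums_finite[of "{..2}" "\<lambda>k. coeff p k * a k"] coeff_p
    by (simp add: p_def numeral_2_eq_2 algebra_simps)
  have d_sums: "(\<lambda>k. d k * s ^ k) sums
      (exp (sqrt 2 * x * s - s\<^sup>2 / 2) - exp C * (1 + (sqrt 2 * x * s - s\<^sup>2 / 2 - C)))" for s
    using sums_diff[OF c_sums[of s] p_sums[of "\<lambda>k. s ^ k"]]
    by (simp add: d_def algebra_simps)
  have tangent: "exp C * (1 + (y - C)) \<le> exp y" for y
    using mult_left_mono[OF exp_ge_add_one_self[of "y - C"], of "exp C"]
    by (simp add: exp_diff)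
  have d_nonneg: "0 \<le> (\<Sum>k. d k * s ^ k)" for s
    using sums_unique[OF d_sums[of s]] tangent[of "sqrt 2 * x * s - s\<^sup>2 / 2"] by simp
  have d_summ: "summable (\<lambda>k. norm (d k * s ^ k))" for s
    by (rule powser_insidea[OF sums_summable[OF d_sums[of "\<bar>s\<bar> + 1"]]]) auto
  have p_transform: "(\<lambda>k. coeff p k * (sqrt (fact k) * t ^ k)) sums exp C"
  proof -
    have "sqrt 2 * t\<^sup>2 / 2 = t\<^sup>2 / sqrt 2"
      by (simp add: field_simps)
    then have "(1 - C) * (sqrt (fact 0) * t ^ 0) + sqrt 2 * x * (sqrt (fact 1) * t ^ 1)
            - sqrt (fact 2) * t ^ 2 / 2 = 1"
      by (simp add: C_def)
    then show ?thesis using p_sums[of "\<lambda>k. sqrt (fact k) * t ^ k"] by (simp only: mult_1_right)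
  qed
  have d_eq: "d k * sqrt (fact k) * t ^ k =
      orthonormal_hermite k x * t ^ k - coeff p k * (sqrt (fact k) * t ^ k)" for k
    by (simp add: d_def c_def algebra_simps)
  have "summable (\<lambda>k. norm (coeff p k * (sqrt (fact k) * t ^ k)))"
    using coeff_p by (intro summable_finite[of "{..2}"]) auto
  then have "summable (\<lambda>k. norm (d k * sqrt (fact k) * t ^ k))"
    unfolding d_eq
    by (rule summable_comparison_test'[OF summable_add[OF assms], where N = 0])
       (simp only: real_norm_def abs_abs abs_triangle_ineq4)
  from suminf_sqrt_fact_nonneg[OF d_summ d_nonneg this]
  have "0 \<le> (\<Sum>k. orthonormal_hermite k x * t ^ k) - exp C"
    unfolding d_eq
    using suminf_diff[OF summable_norm_cancel[OF assms] sums_summable[OF p_transform]]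
      sums_unique[OF p_transform] by simp
  then show ?thesis by (simp add: C_def)
qed

theorem theorem4p1:
  shows "(\<forall>t\<in>ball (0::complex) 1. \<forall>x::real.
            summable (\<lambda>k. complex_of_real (orthonormal_hermite k x) * t ^ k)) \<and>
         continuous_on (ball (0::complex) 1 \<times> (UNIV :: real set)) (\<lambda>(t, x). hermite_gen t x) \<and>
         (\<forall>t x :: real. -1 < t \<and> t < 1 \<longrightarrow>
            hermite_gen (complex_of_real t) x \<in> \<real> \<and> 0 < Re (hermite_gen (complex_of_real t) x))"
proof (intro conjI ballI allI impI)
  fix t :: complex and x :: real
  assume "t \<in> ball 0 1"
  then show "summable (\<lambda>k. complex_of_real (orthonormal_hermite k x) * t ^ k)"
    by (intro summable_norm_cancel[OF summable_norm_hermite_gen]) simp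
next
  show "continuous_on (ball (0::complex) 1 \<times> (UNIV :: real set)) (\<lambda>(t, x). hermite_gen t x)"
    by (rule continuous_on_hermite_gen)
next
  fix t x :: real
  assume t: "-1 < t \<and> t < 1"
  have summ: "summable (\<lambda>k. norm (orthonormal_hermite k x * t ^ k))"
    using summable_norm_hermite_gen[of "of_real t" x] t
    by (simp add: norm_mult norm_power abs_mult power_abs abs_less_iff)
  then have eq: "hermite_gen (of_real t) x = of_real (\<Sum>k. orthonormal_hermite k x * t ^ k)"
    using suminf_of_real[OF summable_norm_cancel[OF summ], where 'a = complex]
    by (simp add: hermite_gen_def)
  show "hermite_gen (complex_of_real t) x \<in> \<real>" unfolding eq by simp
  show "0 < Re (hermite_gen (complex_of_real t) x)"
    unfolding eq using less_le_trans[OF exp_gt_zero orthonormal_hermite_suminf_ge[OF summ]] by simp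
qed

end
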